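(* Let $0<q<1$ and let $P$ be a poset on $\{x_1,\dots,x_n\}$ with labeling $\omega_n(x_i)=i$. Then \[ V_q(\mathcal O(P))=\int_{\mathcal O(P)} d_qx_1\cdots d_qx_n=(1-q)^n\sum_{\sigma} q^{|\sigma|}, \] where the sum is over all $(P,\omega_n)$-partitions $\sigma$. Equivalently, \[ V_q(\mathcal O(P))=\frac{1}{[n]_q!}\sum_{\pi\in\mathcal L(P,\omega_n)} q^{\mathrm{maj}(\pi)}. \]
   Context: For $0<q<1$, $\int_a^b g(x)\,d_qx=(1-q)\sum_{i\ge0}(g(bq^i)bq^i-g(aq^i)aq^i)$; for a convex polytope $D\subset\mathbb R^n$, $\int_D f\,d_qx_1\cdots d_qx_n$ is the iterated $q$-integral with $x_1$ innermost, $x_n$ outermost, $x_i$ running from the minimum to the maximum of $\{y_i:(y_1,\dots,y_n)\in D,\ y_j=x_j\ \forall j>i\}$. The order polytope is $\mathcal O(P)=\{(x_1,\dots,x_n)\in[0,1]^n: x_i\le x_j \text{ whenever } x_i\le_P x_j\}$. A $(P,\omega)$-partition (for a bijection $\omega:P\to[n]$) is $\sigma:P\to\mathbb Z_{\ge0}$ with $\sigma(x)\ge\sigma(y)$ if $x\le_P y$ and $\sigma(x)>\sigma(y)$ if $x\le_P y$ and $\omega(x)>\omega(y)$; $|\sigma|=\sum_x\sigma(x)$. $\mathcal L(P,\omega)$ is the set of permutations $\omega(t_1)\cdots\omega(t_n)$ where $(t_1,\dots,t_n)$ ranges over linear extensions of $P$ (arrangements of all elements with $t_i<_P t_j\Rightarrow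 i<j$). For $\pi\in S_n$, $\mathrm{maj}(\pi)=\sum\{i\in[n-1]:\pi_i>\pi_{i+1}\}$. $[n]_q=(1-q^n)/(1-q)$, $[n]_q!=[1]_q\cdots[n]_q$. *)

theory Defs
  imports "HOL-Analysis.Analysis" "HOL-Combinatorics.Combinatorics"
begin

section \<open>Iterated q-integrals\<close>

definition q_integral :: "real \<Rightarrow> real \<Rightarrow> real \<Rightarrow> (real \<Rightarrow> real) \<Rightarrow> real" where
  "q_integral q a b g =
     (1 - q) * (\<Sum>i. g (b * q ^ i) * (b * q ^ i) - g (a * q ^ i) * (a * q ^ i))"

text \<open>
  A point of \<open>\<real>\<^sup>n\<close> is a function in \<open>{1..n} \<rightarrow>\<^sub>E UNIV\<close>, so that \<open>n\<close> may vary and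
  the coordinates can be integrated out one at a time.
\<close>

definition coord_range ::
    "nat \<Rightarrow> (nat \<Rightarrow> real) set \<Rightarrow> nat \<Rightarrow> (nat \<Rightarrow> real) \<Rightarrow> real set" where
  "coord_range n D i v = {y i | y. y \<in> D \<and> (\<forall>j\<in>{i<..n}. y j = v j)}"

text \<open>
  \<open>iterated_q_integral q n D f k v\<close> integrates over the coordinates \<open>1, \<dots>, k\<close> (coordinate 1
  innermost), the coordinates above \<open>k\<close> being fixed to those of \<open>v\<close>. For compact \<open>D\<close> a nonempty
  \<^const>\<open>coord_range\<close> is compact, and then \<^const>\<open>Inf\<close> and \<^const>\<open>Sup\<close> are its minimum and
  maximum. A q-integral from \<open>a\<close> to \<open>b\<close> also samples the points \<open>a q\<^sup>i < a\<close>, which may lie outside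
  the projection of \<open>D\<close>; the range of an inner variable can then be empty, and the inner
  integral is taken to be 0.
\<close>

primrec iterated_q_integral ::
    "real \<Rightarrow> nat \<Rightarrow> (nat \<Rightarrow> real) set \<Rightarrow> ((nat \<Rightarrow> real) \<Rightarrow> real) \<Rightarrow> nat \<Rightarrow> (nat \<Rightarrow> real) \<Rightarrow> real"
where
  "iterated_q_integral q n D f 0 v = f v"
| "iterated_q_integral q n D f (Suc k) v =
     (if coord_range n D (Suc k) v = {} then 0
      else q_integral q (Inf (coord_range n D (Suc k) v)) (Sup (coord_range n D (Suc k) v))
             (\<lambda>t. iterated_q_integral q n D f k (v(Suc k := t))))"

definition polytope_q_integral ::
    "real \<Rightarrow> nat \<Rightarrow> (nat \<Rightarrow> real) set \<Rightarrow> ((nat \<Rightarrow> real) \<Rightarrow> real) \<Rightarrow> real" where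
  "polytope_q_integral q n D f = iterated_q_integral q n D f n (\<lambda>_. undefined)"

definition q_volume :: "real \<Rightarrow> nat \<Rightarrow> (nat \<Rightarrow> real) set \<Rightarrow> real" where
  "q_volume q n D = polytope_q_integral q n D (\<lambda>_. 1)"

section \<open>Order polytopes and labeled posets\<close>

text \<open>
  A poset is given by its carrier \<open>A\<close> and its order relation \<open>r\<close>, with
  \<^term>\<open>partial_order_on A r\<close>; the pair \<open>(s, t) \<in> r\<close> means \<open>s \<le> t\<close>. In the order polytope the
  carrier is \<open>x ` {1..n}\<close>, with \<open>x\<close> injective on \<open>{1..n}\<close>.
\<close>

definition order_polytope ::
    "nat \<Rightarrow> (nat \<Rightarrow> 'a) \<Rightarrow> ('a \<times> 'a) set \<Rightarrow> (nat \<Rightarrow> real) set" where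
  "order_polytope n x r =
     {v \<in> {1..n} \<rightarrow>\<^sub>E {0..1}. \<forall>i\<in>{1..n}. \<forall>j\<in>{1..n}. (x i, x j) \<in> r \<longrightarrow> v i \<le> v j}"

definition P_partitions ::
    "'a set \<Rightarrow> ('a \<times> 'a) set \<Rightarrow> ('a \<Rightarrow> nat) \<Rightarrow> ('a \<Rightarrow> nat) set" where
  "P_partitions A r \<omega> =
     {\<sigma> \<in> A \<rightarrow>\<^sub>E UNIV. \<forall>s\<in>A. \<forall>t\<in>A. (s, t) \<in> r \<longrightarrow>
        \<sigma> s \<ge> \<sigma> t \<and> (\<omega> s > \<omega> t \<longrightarrow> \<sigma> s > \<sigma> t)}"

definition linear_extensions :: "'a set \<Rightarrow> ('a \<times> 'a) set \<Rightarrow> 'a list set" where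
  "linear_extensions A r =
     {ts \<in> permutations_of_set A. \<forall>i<length ts. \<forall>j<length ts.
        (ts ! i, ts ! j) \<in> r \<and> ts ! i \<noteq> ts ! j \<longrightarrow> i < j}"

definition Jordan_Hoelder :: "'a set \<Rightarrow> ('a \<times> 'a) set \<Rightarrow> ('a \<Rightarrow> nat) \<Rightarrow> nat list set" where
  "Jordan_Hoelder A r \<omega> = map \<omega> ` linear_extensions A r"

text \<open>Lists are indexed from 0: the letter \<open>\<pi>\<^sub>i\<close> of the word \<open>\<pi>\<close> is \<open>\<pi> ! (i - 1)\<close>.\<close>

definition maj :: "nat list \<Rightarrow> nat" where
  "maj \<pi> = \<Sum>{i \<in> {1..<length \<pi>}. \<pi> ! (i - 1) > \<pi> ! i}"

definition q_bracket :: "real \<Rightarrow> nat \<Rightarrow> real" where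
  "q_bracket q n = (1 - q ^ n) / (1 - q)"

definition q_fact :: "real \<Rightarrow> nat \<Rightarrow> real" where
  "q_fact q n = (\<Prod>k=1..n. q_bracket q k)"

end

theory Submission
  imports Defs
begin

text \<open>
  In the iterated integral every limit of integration is \<open>0\<close> or a power of \<open>q\<close>, as the outer
  coordinates are. A q-integral between two such limits telescopes to the samples \<open>a < q\<^sup>m \<le> b\<close>,
  and with \<open>x\<^sub>i = q\<close> to the power \<open>\<sigma>\<^sub>i\<close> the half-open interval gives a strict inequality exactly
  for a relation \<open>x\<^sub>j \<le>\<^sub>P x\<^sub>i\<close> with \<open>j > i\<close>: the integral is the sum over the
  \<open>(P, \<omega>)\<close>-partitions \<open>\<sigma>\<close>.
  For the second formula (Stanley), sort the labels by decreasing \<open>\<sigma>\<close>, ties by increasing label.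
  The resulting word is a linear extension iff \<open>\<sigma>\<close> is a \<open>(P, \<omega>)\<close>-partition, and the
  \<open>\<sigma>\<close> with a given word \<open>\<pi>\<close> are the sequences that decrease weakly along \<open>\<pi>\<close>, strictly at its
  descents; their generating function is \<open>q\<close> to the power \<open>maj \<pi>\<close>, divided by
  \<open>(1 - q) \<cdots> (1 - q\<^sup>n)\<close>.
\<close>

section \<open>Infinite sums and q-integrals\<close>

text \<open>Used twice: P-partitions are grouped by their sorting word, and extensions by their
  value at the next element. \<open>B\<close> may exceed the image, since an empty fibre adds
  0.\<close>

lemma infsum_fibres:
  fixes f :: "'a \<Rightarrow> 'b::banach"
  assumes "f summable_on A" and "h ` A \<subseteq> B"
  shows "infsum f A = (\<Sum>\<^sub>\<infinity>y\<in>B. \<Sum>\<^sub>\<infinity>x\<in>{x \<in> A. h x = y}. f x)"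
proof -
  let ?S = "SIGMA y:B. {x \<in> A. h x = y}"
  have bij: "bij_betw snd ?S A"
    using assms(2) by (intro bij_betwI[where g = "\<lambda>x. (h x, x)"]) auto
  have "(\<lambda>p. f (snd p)) summable_on ?S"
    using summable_on_reindex_bij_betw[OF bij, of f] assms(1) by simp
  then have "(\<Sum>\<^sub>\<infinity>y\<in>B. \<Sum>\<^sub>\<infinity>x\<in>{x \<in> A. h x = y}. f x) = (\<Sum>\<^sub>\<infinity>p\<in>?S. f (snd p))"
    using infsum_Sigma_banach[of "\<lambda>p. f (snd p)" B "\<lambda>y. {x \<in> A. h x = y}"] by simp
  also have "\<dots> = infsum f A"
    by (rule infsum_reindex_bij_betw[OF bij])
  finally show ?thesis ..
qed

lemma
  fixes q :: real and d :: "'i \<Rightarrow> nat"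
  assumes "0 < q" "q < 1" and "finite I" and "\<And>i. i \<in> I \<Longrightarrow> d i > 0"
  shows infsum_power_PiE:
      "(\<Sum>\<^sub>\<infinity>c\<in>I \<rightarrow>\<^sub>E UNIV. q ^ (\<Sum>i\<in>I. d i * c i)) = (\<Prod>i\<in>I. 1 / (1 - q ^ d i))"
    and summable_power_PiE: "(\<lambda>c. q ^ (\<Sum>i\<in>I. d i * c i)) summable_on (I \<rightarrow>\<^sub>E UNIV)"
proof -
  have lt1: "q ^ d i < 1" if "i \<in> I" for i
    using assms that by (simp add: power_Suc_less_one power_less_one_iff)
  have hs: "((\<lambda>m. q ^ (d i * m)) has_sum (1 / (1 - q ^ d i))) UNIV" if "i \<in> I" for i
    unfolding power_mult using geometric_sums[of "q ^ d i"] lt1[OF that] assms(1)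
    by (intro sums_nonneg_imp_has_sum) auto
  have abs: "(\<lambda>m. norm (q ^ (d i * m))) summable_on UNIV" if "i \<in> I" for i
    using has_sum_imp_summable[OF hs[OF that]] assms(1) by simp
  have "(\<Sum>\<^sub>\<infinity>c\<in>I \<rightarrow>\<^sub>E UNIV. \<Prod>i\<in>I. q ^ (d i * c i)) = (\<Prod>i\<in>I. \<Sum>\<^sub>\<infinity>m. q ^ (d i * m))"
    using infsum_prod_PiE_abs[OF assms(3), of "\<lambda>i m. q ^ (d i * m)" "\<lambda>_. UNIV"] abs by simp
  also have "\<dots> = (\<Prod>i\<in>I. 1 / (1 - q ^ d i))"
    by (intro prod.cong refl infsumI hs)
  finally show *: "(\<Sum>\<^sub>\<infinity>c\<in>I \<rightarrow>\<^sub>E UNIV. q ^ (\<Sum>i\<in>I. d i * c i)) = (\<Prod>i\<in>I. 1 / (1 - q ^ d i))"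
    by (simp add: power_sum)
  \<comment> \<open>A divergent \<open>infsum\<close> is 0 by convention, so a nonzero value already
    proves summability.\<close>
  have "(\<Prod>i\<in>I. 1 / (1 - q ^ d i)) \<noteq> 0"
    using lt1 assms(3) by fastforce
  with * have "(\<Sum>\<^sub>\<infinity>c\<in>I \<rightarrow>\<^sub>E UNIV. q ^ (\<Sum>i\<in>I. d i * c i)) \<noteq> 0"
    by metis
  then show "(\<lambda>c. q ^ (\<Sum>i\<in>I. d i * c i)) summable_on (I \<rightarrow>\<^sub>E UNIV)"
    by (rule contrapos_np) (rule infsum_not_exists)
qed

text \<open>
  The samples of a q-integral below its lower limit \<open>a = q\<^sup>s\<close> cancel: they are also samples
  of the upper limit.
\<close>

lemma q_integral_lattice:
  fixes q :: real
  assumes q: "0 < q" "q < 1" and a: "a = 0 \<or> a = q ^ s" and b: "b = q ^ r" and "a \<le> b"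
    and summable: "(\<lambda>j. g (q ^ j) * q ^ j) summable_on UNIV"
  shows "q_integral q a b g = (1 - q) * (\<Sum>\<^sub>\<infinity>j\<in>{j. a < q ^ j \<and> q ^ j \<le> b}. g (q ^ j) * q ^ j)"
proof -
  let ?h = "\<lambda>j. g (q ^ j) * q ^ j"
  have sub: "?h summable_on S" for S
    using summable by (rule summable_on_subset_banach) simp
  have tail: "(\<lambda>i. ?h (m + i)) sums infsum ?h {m..}" for m
  proof -
    have bij: "bij_betw ((+) m) UNIV {m..}"
      by (intro bij_betwI[where g = "\<lambda>j. j - m"]) auto
    have "((\<lambda>i. ?h (m + i)) has_sum infsum ?h {m..}) UNIV"
      using has_sum_reindex_bij_betw[OF bij, of ?h] has_sum_infsum[OF sub] by blast
    then show ?thesis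
      by (rule has_sum_imp_sums)
  qed
  have le: "q ^ i \<le> q ^ j \<longleftrightarrow> j \<le> i" and less: "q ^ i < q ^ j \<longleftrightarrow> j < i" for i j
    using q by (auto simp: power_decreasing_iff power_strict_decreasing_iff)
  show ?thesis
  proof (cases "a = 0")
    case True
    \<comment> \<open>Every power of \<open>q\<close> is positive, and the samples at the lower
      limit 0 have weight 0.\<close>
    have "{j. a < q ^ j \<and> q ^ j \<le> b} = {r..}"
      using True b q by (auto simp: le)
    moreover have "(\<Sum>i. ?h (r + i)) = infsum ?h {r..}"
      by (rule sums_unique[OF tail, symmetric])
    ultimately show ?thesis
      using True b by (simp add: q_integral_def power_add)
  next
    case False
    then have a: "a = q ^ s"
      using a by simp
    with \<open>a \<le> b\<close> b have rs: "r \<le> s"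
      by (simp add: le)
    have set: "{j. a < q ^ j \<and> q ^ j \<le> b} = {r..} - {s..}"
      using a b by (auto simp: le less)
    have "(\<Sum>i. ?h (r + i) - ?h (s + i)) = infsum ?h {r..} - infsum ?h {s..}"
      by (rule sums_unique[OF sums_diff[OF tail tail], symmetric])
    also have "\<dots> = infsum ?h ({r..} - {s..})"
      using rs by (intro infsum_Diff[symmetric] sub) auto
    finally show ?thesis
      using a b set by (simp add: q_integral_def power_add)
  qed
qed

section \<open>The generating function of P-partitions\<close>

lemma sum_nat_telescope:
  fixes u :: "nat \<Rightarrow> nat"
  assumes "i \<le> n" and "\<And>j. i \<le> j \<Longrightarrow> j < n \<Longrightarrow> u (Suc j) \<le> u j"
  shows "(\<Sum>j\<in>{i..<n}. u j - u (Suc j)) + u n = u i"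
  using assms
proof (induction i rule: inc_induct)
  case (step i)
  then have "(\<Sum>j\<in>{Suc i..<n}. u j - u (Suc j)) + u n = u (Suc i)" and "u (Suc i) \<le> u i"
    by auto
  with step.hyps show ?case
    by (subst sum.atLeast_Suc_lessThan) auto
qed simp

text \<open>Exchange the summations: \<open>u j\<close> occurs in the tails that start at 0, ...,
  \<open>j\<close>.\<close>

lemma sum_tails: "(\<Sum>i<n. \<Sum>j\<in>{i..<n}. u j) = (\<Sum>j<n. Suc j * u j)" for u :: "nat \<Rightarrow> nat"
  by (induction n) (simp_all add: sum.distrib)

text \<open>
  The sequences \<open>w\<close> with drops \<open>w\<^sub>i - w\<^sub>i\<^sub>+\<^sub>1 \<ge> e\<^sub>i\<close> (where \<open>w\<^sub>n = 0\<close>) are parametrized by the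
  excesses \<open>c\<^sub>i = w\<^sub>i - w\<^sub>i\<^sub>+\<^sub>1 - e\<^sub>i\<close>.
\<close>

lemma infsum_sequences_with_drops:
  fixes q :: real and e :: "nat \<Rightarrow> nat"
  assumes q: "0 < q" "q < 1"
  shows "(\<Sum>\<^sub>\<infinity>w\<in>{w \<in> {..<n} \<rightarrow>\<^sub>E UNIV. \<forall>i<n. (if Suc i < n then w (Suc i) else 0) + e i \<le> w i}.
            q ^ (\<Sum>i<n. w i)) =
         q ^ (\<Sum>i<n. Suc i * e i) * (\<Prod>i<n. 1 / (1 - q ^ Suc i))"
proof -
  let ?next = "\<lambda>w i. if Suc i < n then w (Suc i) else 0"
  let ?W = "{w \<in> {..<n} \<rightarrow>\<^sub>E UNIV. \<forall>i<n. ?next w i + e i \<le> w i}"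
  define \<phi> where "\<phi> c = (\<lambda>i\<in>{..<n}. \<Sum>j\<in>{i..<n}. c j + e j)" for c :: "nat \<Rightarrow> nat"
  define \<psi> where "\<psi> w = (\<lambda>i\<in>{..<n}. w i - ?next w i - e i)" for w :: "nat \<Rightarrow> nat"
  have \<phi>_rec: "\<phi> c i = c i + e i + ?next (\<phi> c) i" if "i < n" for c i
    using that by (auto simp: \<phi>_def sum.atLeast_Suc_lessThan)
  have \<phi>_\<psi>: "\<phi> (\<psi> w) = w" if w: "w \<in> ?W" for w
  proof
    fix i
    \<comment> \<open>Extension by 0 makes the last drop an ordinary one, and the drops telescope
      down to \<open>u n = 0\<close>.\<close>
    define u where "u j = (if j < n then w j else 0)" for j
    have drop: "u (Suc j) + e j \<le> u j" if "j < n" for j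
      using w that by (simp add: u_def)
    have "(\<Sum>j\<in>{i..<n}. \<psi> w j + e j) = (\<Sum>j\<in>{i..<n}. u j - u (Suc j))"
    proof (rule sum.cong)
      fix j assume "j \<in> {i..<n}"
      then show "\<psi> w j + e j = u j - u (Suc j)"
        using drop[of j] by (simp add: \<psi>_def u_def)
    qed simp
    moreover have "(\<Sum>j\<in>{i..<n}. u j - u (Suc j)) = u i" if "i < n"
    proof -
      have "u n = 0"
        by (simp add: u_def)
      then show ?thesis
        using sum_nat_telescope[of i n u] add_leD1[OF drop] that by simp
    qed
    ultimately have "\<phi> (\<psi> w) i = w i" if "i < n"
      using that by (simp add: \<phi>_def u_def)
    moreover have "w i = undefined" if "\<not> i < n"
      using w that by (auto intro: PiE_arb)
    ultimately show "\<phi> (\<psi> w) i = w i"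
      by (cases "i < n") (simp_all add: \<phi>_def)
  qed
  have bij: "bij_betw \<phi> ({..<n} \<rightarrow>\<^sub>E UNIV) ?W"
  proof (rule bij_betw_byWitness[where f' = \<psi>])
    show "\<forall>c\<in>{..<n} \<rightarrow>\<^sub>E UNIV. \<psi> (\<phi> c) = c"
    proof
      fix c :: "nat \<Rightarrow> nat" assume c: "c \<in> {..<n} \<rightarrow>\<^sub>E UNIV"
      show "\<psi> (\<phi> c) = c"
      proof
        fix i
        have "\<psi> (\<phi> c) i = \<phi> c i - ?next (\<phi> c) i - e i" if "i < n"
          using that by (simp add: \<psi>_def)
        then have "\<psi> (\<phi> c) i = c i" if "i < n"
          using \<phi>_rec[OF that, of c] that by linarith
        moreover have "c i = undefined" if "\<not> i < n"
          using c that by (auto intro: PiE_arb)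
        ultimately show "\<psi> (\<phi> c) i = c i"
          by (cases "i < n") (simp_all add: \<psi>_def)
      qed
    qed
    show "\<phi> ` ({..<n} \<rightarrow>\<^sub>E UNIV) \<subseteq> ?W"
    proof clarify
      fix c :: "nat \<Rightarrow> nat"
      have "?next (\<phi> c) i + e i \<le> \<phi> c i" if "i < n" for i
        using \<phi>_rec[OF that, of c] by linarith
      moreover have "\<phi> c \<in> {..<n} \<rightarrow>\<^sub>E UNIV"
        by (simp add: \<phi>_def)
      ultimately show "\<phi> c \<in> {..<n} \<rightarrow>\<^sub>E UNIV \<and> (\<forall>i<n. ?next (\<phi> c) i + e i \<le> \<phi> c i)"
        by blast
    qed
  qed (use \<phi>_\<psi> in \<open>auto simp: \<psi>_def\<close>)
  have size: "(\<Sum>i<n. \<phi> c i) = (\<Sum>i<n. Suc i * e i) + (\<Sum>i<n. Suc i * c i)" for c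
  proof -
    have "(\<Sum>i<n. \<phi> c i) = (\<Sum>i<n. \<Sum>j\<in>{i..<n}. c j + e j)"
      by (simp add: \<phi>_def)
    then show ?thesis
      by (simp add: sum_tails sum.distrib algebra_simps)
  qed
  have "(\<Sum>\<^sub>\<infinity>w\<in>?W. q ^ (\<Sum>i<n. w i)) = (\<Sum>\<^sub>\<infinity>c\<in>{..<n} \<rightarrow>\<^sub>E UNIV. q ^ (\<Sum>i<n. \<phi> c i))"
    by (rule infsum_reindex_bij_betw[OF bij, symmetric])
  also have "\<dots> = q ^ (\<Sum>i<n. Suc i * e i) * (\<Sum>\<^sub>\<infinity>c\<in>{..<n} \<rightarrow>\<^sub>E UNIV. q ^ (\<Sum>i<n. Suc i * c i))"
    unfolding size power_add by (rule infsum_cmult_right')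
  also have "\<dots> = q ^ (\<Sum>i<n. Suc i * e i) * (\<Prod>i<n. 1 / (1 - q ^ Suc i))"
    using infsum_power_PiE[OF q, of "{..<n}" Suc] by simp
  finally show ?thesis .
qed

text \<open>Reading \<sigma> along \<open>t\<close> gives a sequence whose drops must be at least 1
  at the descents of \<open>t\<close> and at least 0 elsewhere. A forced drop raises all values up
  to its position, so the smallest such sequence has sum \<open>maj t\<close>.\<close>

lemma infsum_sequences_along_word:
  fixes q :: real
  assumes q: "0 < q" "q < 1" and t: "t \<in> permutations_of_set {1..n}"
  shows "(\<Sum>\<^sub>\<infinity>\<sigma>\<in>{\<sigma> \<in> {1..n} \<rightarrow>\<^sub>E UNIV. \<forall>i. Suc i < n \<longrightarrow>
              \<sigma> (t ! Suc i) + of_bool (t ! Suc i < t ! i) \<le> \<sigma> (t ! i)}. q ^ (\<Sum>s\<in>{1..n}. \<sigma> s)) =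
         q ^ maj t * (\<Prod>i<n. 1 / (1 - q ^ Suc i))"
proof -
  define e :: "nat \<Rightarrow> nat" where "e i = of_bool (Suc i < n \<and> t ! Suc i < t ! i)" for i
  let ?T = "{\<sigma> \<in> {1..n} \<rightarrow>\<^sub>E (UNIV :: nat set). \<forall>i. Suc i < n \<longrightarrow>
              \<sigma> (t ! Suc i) + of_bool (t ! Suc i < t ! i) \<le> \<sigma> (t ! i)}"
  let ?W = "{w \<in> {..<n} \<rightarrow>\<^sub>E UNIV. \<forall>i<n. (if Suc i < n then w (Suc i) else 0) + e i \<le> w i}"
  have len: "length t = n" and "distinct t" and set: "set t = {1..n}"
    using t by (auto simp: permutations_of_set_def distinct_card[symmetric])
  then have nth: "bij_betw ((!) t) {..<n} {1..n}"
    by (simp add: bij_betw_nth)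
  define pos where "pos = the_inv_into {..<n} ((!) t)"
  have pos: "pos a \<in> {..<n}" "t ! pos a = a" if "a \<in> {1..n}" for a
    using nth that bij_betwE[OF bij_betw_the_inv_into[OF nth]]
    unfolding pos_def bij_betw_def by (auto intro: f_the_inv_into_f)
  have pos_nth: "pos (t ! i) = i" if "i < n" for i
    using nth that unfolding pos_def bij_betw_def by (simp add: the_inv_into_f_f)
  have nth_in: "t ! i \<in> {1..n}" if "i < n" for i
    using nth that by (auto simp: bij_betw_def)
  have bij: "bij_betw (\<lambda>\<sigma>. \<lambda>i\<in>{..<n}. \<sigma> (t ! i)) ?T ?W"
  proof (rule bij_betw_byWitness[where f' = "\<lambda>w. \<lambda>a\<in>{1..n}. w (pos a)"])
    show "\<forall>\<sigma>\<in>?T. (\<lambda>a\<in>{1..n}. (\<lambda>i\<in>{..<n}. \<sigma> (t ! i)) (pos a)) = \<sigma>"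
    proof
      fix \<sigma> assume "\<sigma> \<in> ?T"
      then have \<sigma>: "\<sigma> \<in> {1..n} \<rightarrow>\<^sub>E UNIV"
        by simp
      show "(\<lambda>a\<in>{1..n}. (\<lambda>i\<in>{..<n}. \<sigma> (t ! i)) (pos a)) = \<sigma>"
      proof
        fix a show "(\<lambda>a\<in>{1..n}. (\<lambda>i\<in>{..<n}. \<sigma> (t ! i)) (pos a)) a = \<sigma> a"
          using pos[of a] PiE_arb[OF \<sigma>, of a] by (cases "a \<in> {1..n}") simp_all
      qed
    qed
    show "\<forall>w\<in>?W. (\<lambda>i\<in>{..<n}. (\<lambda>a\<in>{1..n}. w (pos a)) (t ! i)) = w"
    proof
      fix w assume "w \<in> ?W"
      then have w: "w \<in> {..<n} \<rightarrow>\<^sub>E UNIV"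
        by simp
      show "(\<lambda>i\<in>{..<n}. (\<lambda>a\<in>{1..n}. w (pos a)) (t ! i)) = w"
      proof
        fix i show "(\<lambda>i\<in>{..<n}. (\<lambda>a\<in>{1..n}. w (pos a)) (t ! i)) i = w i"
          using pos_nth[of i] nth_in[of i] PiE_arb[OF w, of i] by (cases "i < n") simp_all
      qed
    qed
    show "(\<lambda>\<sigma>. \<lambda>i\<in>{..<n}. \<sigma> (t ! i)) ` ?T \<subseteq> ?W"
    proof (rule image_subsetI)
      fix \<sigma> assume "\<sigma> \<in> ?T"
      then have \<sigma>: "\<sigma> (t ! Suc i) + of_bool (t ! Suc i < t ! i) \<le> \<sigma> (t ! i)" if "Suc i < n" for i
        using that by blast
      let ?w = "\<lambda>i\<in>{..<n}. \<sigma> (t ! i)"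
      have "(if Suc i < n then ?w (Suc i) else 0) + e i \<le> ?w i" if "i < n" for i
        using \<sigma>[of i] that by (cases "Suc i < n") (simp_all add: e_def)
      then show "?w \<in> ?W"
        by simp
    qed
    show "(\<lambda>w. \<lambda>a\<in>{1..n}. w (pos a)) ` ?W \<subseteq> ?T"
    proof (rule image_subsetI)
      fix w assume "w \<in> ?W"
      then have w: "\<forall>i<n. (if Suc i < n then w (Suc i) else 0) + e i \<le> w i"
        by simp
      let ?\<sigma> = "\<lambda>a\<in>{1..n}. w (pos a)"
      have "?\<sigma> (t ! Suc i) + of_bool (t ! Suc i < t ! i) \<le> ?\<sigma> (t ! i)" if "Suc i < n" for i
        using w[rule_format, of i] that pos_nth nth_in[of i] nth_in[of "Suc i"] by (simp add: e_def)
      moreover have "?\<sigma> \<in> {1..n} \<rightarrow>\<^sub>E UNIV"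
        by simp
      ultimately show "?\<sigma> \<in> ?T"
        by blast
    qed
  qed
  have maj: "maj t = (\<Sum>i<n. Suc i * e i)"
  proof -
    \<comment> \<open>The descent between indices \<open>i\<close> and \<open>Suc i\<close>, counted
      from 0, has position \<open>Suc i\<close> in \<open>maj\<close>; this is also the number of
      values that it raises.\<close>
    have "maj t = (\<Sum>i\<in>{i. Suc i < n \<and> t ! Suc i < t ! i}. Suc i)"
      unfolding maj_def len
      by (rule sum.reindex_bij_witness[where i = Suc and j = "\<lambda>i. i - 1"]) auto
    also have "\<dots> = (\<Sum>i<n. Suc i * e i)"
      by (rule sum.mono_neutral_cong_left) (auto simp: e_def)
    finally show ?thesis .
  qed
  have "(\<Sum>i<n. (\<lambda>i\<in>{..<n}. \<sigma> (t ! i)) i) = (\<Sum>s\<in>{1..n}. \<sigma> s)" for \<sigma> :: "nat \<Rightarrow> nat"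
    using sum.reindex_bij_betw[OF nth, of \<sigma>] by simp
  then have "(\<Sum>\<^sub>\<infinity>\<sigma>\<in>?T. q ^ (\<Sum>s\<in>{1..n}. \<sigma> s)) = (\<Sum>\<^sub>\<infinity>w\<in>?W. q ^ (\<Sum>i<n. w i))"
    using infsum_reindex_bij_betw[OF bij, of "\<lambda>w. q ^ (\<Sum>i<n. w i)"] by simp
  then show ?thesis
    using infsum_sequences_with_drops[OF q, of n e] maj by simp
qed

text \<open>
  The key orders \<open>{1..n}\<close> by decreasing value of \<open>\<sigma>\<close>, ties being broken by the labels.
\<close>

definition sort_key_of :: "nat \<Rightarrow> (nat \<Rightarrow> nat) \<Rightarrow> nat \<Rightarrow> int" where
  "sort_key_of n \<sigma> a = int a - int n * int (\<sigma> a)"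

text \<open>The keys are pairwise distinct, so the sorted keys can be read back as labels.\<close>

definition sorting_word :: "nat \<Rightarrow> (nat \<Rightarrow> nat) \<Rightarrow> nat list" where
  "sorting_word n \<sigma> =
     map (the_inv_into {1..n} (sort_key_of n \<sigma>)) (sorted_list_of_set (sort_key_of n \<sigma> ` {1..n}))"

text \<open>Labels in \<open>{1..n}\<close> differ by less than \<open>n\<close>, so one unit of
  \<sigma>, scaled by \<open>n\<close>, outweighs any difference of labels.\<close>

lemma sort_key_of_less_iff:
  assumes "a \<in> {1..n}" and "b \<in> {1..n}"
  shows "sort_key_of n \<sigma> a < sort_key_of n \<sigma> b \<longleftrightarrow> \<sigma> b < \<sigma> a \<or> \<sigma> b = \<sigma> a \<and> a < b"
proof -
  have less: "sort_key_of n \<sigma> a < sort_key_of n \<sigma> b"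
    if "a \<in> {1..n}" and "b \<in> {1..n}" and "\<sigma> b < \<sigma> a" for a b
  proof -
    have "int n * (int (\<sigma> b) + 1) \<le> int n * int (\<sigma> a)"
      using that by (intro mult_left_mono) auto
    then show ?thesis
      using that by (auto simp: sort_key_of_def algebra_simps)
  qed
  show ?thesis
    using less[of a b] less[of b a] assms
    by (cases "\<sigma> a" "\<sigma> b" rule: linorder_cases) (auto simp: sort_key_of_def)
qed

lemma inj_on_sort_key_of: "inj_on (sort_key_of n \<sigma>) {1..n}"
proof (rule inj_onI)
  fix a b assume ab: "a \<in> {1..n}" "b \<in> {1..n}" and "sort_key_of n \<sigma> a = sort_key_of n \<sigma> b"
  with sort_key_of_less_iff[OF ab] sort_key_of_less_iff[OF ab(2,1)] show "a = b"
    by (metis less_irrefl linorder_neqE_nat)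
qed

text \<open>A strictly increasing list is determined by its set of entries, so only one arrangement
  of the labels has increasing keys.\<close>

lemma sorting_word_eq_iff:
  assumes t: "t \<in> permutations_of_set {1..n}"
  shows "sorting_word n \<sigma> = t \<longleftrightarrow> sorted_wrt (<) (map (sort_key_of n \<sigma>) t)"
proof -
  let ?k = "sort_key_of n \<sigma>"
  have set: "set t = {1..n}"
    using t by (simp add: permutations_of_set_def)
  have "map ?k (sorting_word n \<sigma>) = sorted_list_of_set (?k ` {1..n})"
    unfolding sorting_word_def map_map
    by (rule map_idI) (simp add: f_the_inv_into_f[OF inj_on_sort_key_of] del: One_nat_def)
  moreover have "sorted_wrt (<) (map ?k t) \<longleftrightarrow> map ?k t = sorted_list_of_set (?k ` {1..n})"
    using strict_sorted_equal[of "sorted_list_of_set (?k ` {1..n})" "map ?k t"] set by auto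
  moreover have "sorting_word n \<sigma> = t" if "map ?k t = sorted_list_of_set (?k ` {1..n})"
    unfolding sorting_word_def that[symmetric] map_map
    by (rule map_idI) (simp add: set the_inv_into_f_f[OF inj_on_sort_key_of] del: One_nat_def)
  ultimately show ?thesis
    by metis
qed

lemma sorting_word_permutation: "sorting_word n \<sigma> \<in> permutations_of_set {1..n}"
proof (rule permutations_of_setI)
  let ?k = "sort_key_of n \<sigma>"
  have inj: "inj_on (the_inv_into {1..n} ?k) (?k ` {1..n})"
    by (rule inj_on_the_inv_into[OF inj_on_sort_key_of])
  then show "distinct (sorting_word n \<sigma>)"
    by (simp add: sorting_word_def distinct_map)
  show "set (sorting_word n \<sigma>) = {1..n}"
    using the_inv_into_onto[OF inj_on_sort_key_of, of n \<sigma>] by (simp add: sorting_word_def)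
qed

text \<open>It suffices to compare the keys of neighbours; there the tie-breaking lets \<sigma> stay
  constant only across an ascent of \<open>t\<close>.\<close>

lemma sorting_word_eq_iff_nth:
  assumes t: "t \<in> permutations_of_set {1..n}"
  shows "sorting_word n \<sigma> = t \<longleftrightarrow>
    (\<forall>i. Suc i < n \<longrightarrow> \<sigma> (t ! Suc i) + of_bool (t ! Suc i < t ! i) \<le> \<sigma> (t ! i))"
proof -
  have len: "length t = n" and dist: "distinct t" and set: "set t = {1..n}"
    using t by (auto simp: permutations_of_set_def distinct_card[symmetric])
  have "sort_key_of n \<sigma> (t ! i) < sort_key_of n \<sigma> (t ! Suc i) \<longleftrightarrow>
      \<sigma> (t ! Suc i) + of_bool (t ! Suc i < t ! i) \<le> \<sigma> (t ! i)" if "Suc i < n" for i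
  proof -
    have "t ! i \<in> {1..n}" "t ! Suc i \<in> {1..n}"
      using that len set nth_mem[of i t] nth_mem[of "Suc i" t] by auto
    moreover have "t ! i \<noteq> t ! Suc i"
      using that len dist by (simp add: nth_eq_iff_index_eq)
    ultimately show ?thesis
      by (auto simp: sort_key_of_less_iff)
  qed
  then show ?thesis
    by (simp add: sorting_word_eq_iff[OF t] sorted_wrt_iff_nth_Suc_transp len)
qed

text \<open>Positions in the sorting word compare as the keys do. A relation between distinct
  \<open>a\<close> and \<open>b\<close> thus asks for a smaller key at \<open>a\<close>, which is
  the inequality of a P-partition, strict when \<open>b < a\<close>.\<close>

lemma sorting_word_linear_extension_iff:
  assumes R: "R \<subseteq> {1..n} \<times> {1..n}" and \<sigma>: "\<sigma> \<in> {1..n} \<rightarrow>\<^sub>E UNIV"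
  shows "sorting_word n \<sigma> \<in> linear_extensions {1..n} R \<longleftrightarrow> \<sigma> \<in> P_partitions {1..n} R id"
proof -
  define t where "t = sorting_word n \<sigma>"
  have t: "t \<in> permutations_of_set {1..n}"
    unfolding t_def by (rule sorting_word_permutation)
  then have dist: "distinct t" and set: "set t = {1..n}"
    by (auto simp: permutations_of_set_def)
  have sorted: "sorted_wrt (<) (map (sort_key_of n \<sigma>) t)"
    using sorting_word_eq_iff[OF t] unfolding t_def by blast
  have idx: "i < j \<longleftrightarrow> sort_key_of n \<sigma> (t ! i) < sort_key_of n \<sigma> (t ! j)"
    if "i < length t" "j < length t" for i j
    using that sorted_wrt_nth_less[OF sorted, of i j] sorted_wrt_nth_less[OF sorted, of j i]
    by (cases i j rule: linorder_cases) auto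
  have "t \<in> linear_extensions {1..n} R \<longleftrightarrow>
      (\<forall>i<length t. \<forall>j<length t. (t ! i, t ! j) \<in> R \<and> t ! i \<noteq> t ! j \<longrightarrow>
         sort_key_of n \<sigma> (t ! i) < sort_key_of n \<sigma> (t ! j))"
    using t idx by (auto simp: linear_extensions_def)
  also have "\<dots> \<longleftrightarrow> (\<forall>a\<in>set t. \<forall>b\<in>set t. (a, b) \<in> R \<and> a \<noteq> b \<longrightarrow>
         sort_key_of n \<sigma> a < sort_key_of n \<sigma> b)"
    by (simp add: all_set_conv_all_nth)
  also have "\<dots> \<longleftrightarrow> (\<forall>a\<in>{1..n}. \<forall>b\<in>{1..n}. (a, b) \<in> R \<longrightarrow> \<sigma> b \<le> \<sigma> a \<and> (b < a \<longrightarrow> \<sigma> b < \<sigma> a))"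
    unfolding set
  proof (intro ball_cong refl)
    fix a b assume ab: "a \<in> {1..n}" "b \<in> {1..n}"
    show "((a, b) \<in> R \<and> a \<noteq> b \<longrightarrow> sort_key_of n \<sigma> a < sort_key_of n \<sigma> b) \<longleftrightarrow>
        ((a, b) \<in> R \<longrightarrow> \<sigma> b \<le> \<sigma> a \<and> (b < a \<longrightarrow> \<sigma> b < \<sigma> a))"
      unfolding sort_key_of_less_iff[OF ab]
      by (cases a b rule: linorder_cases) auto
  qed
  also have "\<dots> \<longleftrightarrow> \<sigma> \<in> P_partitions {1..n} R id"
    using \<sigma> by (simp add: P_partitions_def)
  finally show ?thesis
    unfolding t_def .
qed

lemma finite_linear_extensions: "finite (linear_extensions A r)" if "finite A"
  using that unfolding linear_extensions_def by auto

theorem infsum_P_partitions: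
  fixes q :: real
  assumes q: "0 < q" "q < 1" and R: "R \<subseteq> {1..n} \<times> {1..n}"
  shows "(\<Sum>\<^sub>\<infinity>\<sigma>\<in>P_partitions {1..n} R id. q ^ (\<Sum>s\<in>{1..n}. \<sigma> s)) =
         (\<Sum>t\<in>linear_extensions {1..n} R. q ^ maj t) * (\<Prod>i<n. 1 / (1 - q ^ Suc i))"
proof -
  let ?f = "\<lambda>\<sigma>. q ^ (\<Sum>s\<in>{1..n}. \<sigma> s)"
  let ?L = "linear_extensions {1..n} R" and ?PP = "P_partitions {1..n} R id"
  have PP: "?PP \<subseteq> {1..n} \<rightarrow>\<^sub>E UNIV"
    by (auto simp: P_partitions_def)
  have "?f summable_on {1..n} \<rightarrow>\<^sub>E UNIV"
    using summable_power_PiE[OF q, of "{1..n}" "\<lambda>_. 1"] by simp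
  then have "?f summable_on ?PP"
    using PP by (rule summable_on_subset_banach)
  moreover have "sorting_word n ` ?PP \<subseteq> ?L"
    using PP sorting_word_linear_extension_iff[OF R] by blast
  ultimately have "infsum ?f ?PP = (\<Sum>\<^sub>\<infinity>t\<in>?L. infsum ?f {\<sigma> \<in> ?PP. sorting_word n \<sigma> = t})"
    by (rule infsum_fibres)
  also have "\<dots> = (\<Sum>t\<in>?L. infsum ?f {\<sigma> \<in> ?PP. sorting_word n \<sigma> = t})"
    by (simp add: finite_linear_extensions)
  also have "\<dots> = (\<Sum>t\<in>?L. q ^ maj t * (\<Prod>i<n. 1 / (1 - q ^ Suc i)))"
  proof (rule sum.cong)
    fix t assume tL: "t \<in> ?L"
    then have t: "t \<in> permutations_of_set {1..n}"
      by (simp add: linear_extensions_def)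
    \<comment> \<open>Once \<open>t\<close> is a linear extension, every sequence with sorting word
      \<open>t\<close> is a P-partition, so the fibre no longer depends on \<open>R\<close>.\<close>
    have "{\<sigma> \<in> ?PP. sorting_word n \<sigma> = t} = {\<sigma> \<in> {1..n} \<rightarrow>\<^sub>E UNIV. sorting_word n \<sigma> = t}"
      using PP sorting_word_linear_extension_iff[OF R] tL by blast
    then show "infsum ?f {\<sigma> \<in> ?PP. sorting_word n \<sigma> = t} =
        q ^ maj t * (\<Prod>i<n. 1 / (1 - q ^ Suc i))"
      using infsum_sequences_along_word[OF q t] by (simp add: sorting_word_eq_iff_nth[OF t])
  qed simp
  finally show ?thesis
    by (simp only: sum_distrib_right)
qed

section \<open>The iterated q-integral over an order polytope\<close>

locale labeled_poset =
  fixes n :: nat and R :: "(nat \<times> nat) set"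
  assumes partial_order: "partial_order_on {1..n} R"
begin

lemma R_subset: "R \<subseteq> {1..n} \<times> {1..n}"
  and R_refl: "i \<in> {1..n} \<Longrightarrow> (i, i) \<in> R"
  and R_trans: "(i, j) \<in> R \<Longrightarrow> (j, k) \<in> R \<Longrightarrow> (i, k) \<in> R"
  using partial_order
  by (auto simp: partial_order_on_def preorder_on_def refl_on_def trans_def)

abbreviation D :: "(nat \<Rightarrow> real) set" where
  "D \<equiv> order_polytope n id R"

definition in_projection :: "nat \<Rightarrow> (nat \<Rightarrow> real) \<Rightarrow> bool" where
  "in_projection k v \<longleftrightarrow> (\<forall>i\<in>{k<..n}. 0 \<le> v i \<and> v i \<le> 1) \<and>
     (\<forall>i\<in>{k<..n}. \<forall>j\<in>{k<..n}. (i, j) \<in> R \<longrightarrow> v i \<le> v j)"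

text \<open>To extend outer coordinates to a point of \<open>D\<close>, give each element the
  largest of 0 and the outer coordinates below it in the poset. Transitivity makes this monotone;
  reflexivity and the monotonicity of \<open>v\<close> preserve the outer values.\<close>

lemma in_projection_iff: "in_projection k v \<longleftrightarrow> (\<exists>y\<in>D. \<forall>j\<in>{k<..n}. y j = v j)"
proof
  assume v: "in_projection k v"
  define below where "below i = insert 0 (v ` {j \<in> {k<..n}. (j, i) \<in> R})" for i
  have fin: "finite (below i)" "below i \<noteq> {}" for i
    by (auto simp: below_def)
  define y where "y = (\<lambda>i\<in>{1..n}. Max (below i))"
  have "y \<in> D"
  proof -
    have "0 \<le> Max (below i)" "Max (below i) \<le> 1" for i
      using v fin[of i] by (auto simp: below_def in_projection_def)
    moreover have "Max (below i) \<le> Max (below j)" if "(i, j) \<in> R" for i j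
      using R_trans[OF _ that] fin by (intro Max_mono) (auto simp: below_def)
    ultimately show ?thesis
      by (auto simp: order_polytope_def y_def)
  qed
  moreover have "y j = v j" if "j \<in> {k<..n}" for j
  proof -
    have "Max (below j) = v j"
    proof (rule Max_eqI)
      show "a \<le> v j" if "a \<in> below j" for a
        using that v \<open>j \<in> {k<..n}\<close> by (auto simp: below_def in_projection_def)
      show "v j \<in> below j"
        using that R_refl[of j] by (auto simp: below_def)
    qed (rule fin)
    then show ?thesis
      using that by (simp add: y_def)
  qed
  ultimately show "\<exists>y\<in>D. \<forall>j\<in>{k<..n}. y j = v j"
    by blast
next
  assume "\<exists>y\<in>D. \<forall>j\<in>{k<..n}. y j = v j"
  then obtain y where y: "y \<in> D" and eq: "\<And>j. j \<in> {k<..n} \<Longrightarrow> y j = v j"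
    by blast
  have "0 \<le> y i \<and> y i \<le> 1" if "i \<in> {1..n}" for i
    using y that by (auto simp: order_polytope_def PiE_iff)
  moreover have "y i \<le> y j" if "i \<in> {1..n}" "j \<in> {1..n}" "(i, j) \<in> R" for i j
    using y that by (auto simp: order_polytope_def)
  ultimately show "in_projection k v"
    unfolding in_projection_def by (simp add: eq[symmetric] del: One_nat_def)
qed

lemma greaterThanAtMost_Suc_left: "k < n \<Longrightarrow> {k<..n} = insert (Suc k) {Suc k<..n}"
  by auto

lemma coord_range_D:
  assumes "k < n"
  shows "coord_range n D (Suc k) v = {t. in_projection k (v(Suc k := t))}"
  using assms by (auto simp: coord_range_def in_projection_iff greaterThanAtMost_Suc_left)

text \<open>The 0 here and the 1 in \<open>hi\<close> are the bounds of the unit cube; they also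
  keep the sets nonempty.\<close>

definition lo :: "nat \<Rightarrow> (nat \<Rightarrow> real) \<Rightarrow> real" where
  "lo k v = Max (insert 0 (v ` {j \<in> {Suc k<..n}. (j, Suc k) \<in> R}))"

definition hi :: "nat \<Rightarrow> (nat \<Rightarrow> real) \<Rightarrow> real" where
  "hi k v = Min (insert 1 (v ` {j \<in> {Suc k<..n}. (Suc k, j) \<in> R}))"

lemma lo_less_iff: "lo k v < t \<longleftrightarrow> 0 < t \<and> (\<forall>j\<in>{Suc k<..n}. (j, Suc k) \<in> R \<longrightarrow> v j < t)"
  and lo_le_iff: "lo k v \<le> t \<longleftrightarrow> 0 \<le> t \<and> (\<forall>j\<in>{Suc k<..n}. (j, Suc k) \<in> R \<longrightarrow> v j \<le> t)"
  and le_hi_iff: "t \<le> hi k v \<longleftrightarrow> t \<le> 1 \<and> (\<forall>j\<in>{Suc k<..n}. (Suc k, j) \<in> R \<longrightarrow> t \<le> v j)"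
  by (auto simp: lo_def hi_def)

lemma in_projection_upd_iff:
  assumes "k < n"
  shows "in_projection k (v(Suc k := t)) \<longleftrightarrow>
    in_projection (Suc k) v \<and> lo k v \<le> t \<and> t \<le> hi k v"
  using assms unfolding in_projection_def lo_le_iff le_hi_iff greaterThanAtMost_Suc_left[OF assms]
  by auto

text \<open>By transitivity, an outer element below \<open>Suc k\<close> lies below every outer
  element above \<open>Suc k\<close>.\<close>

lemma lo_le_hi:
  assumes "in_projection (Suc k) v"
  shows "lo k v \<le> hi k v"
proof -
  have "v i \<le> v j" if "i \<in> {Suc k<..n}" "j \<in> {Suc k<..n}" "(i, Suc k) \<in> R" "(Suc k, j) \<in> R" for i j
    using assms that R_trans unfolding in_projection_def by blast
  moreover have "0 \<le> v i" "v i \<le> 1" if "i \<in> {Suc k<..n}" for i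
    using assms that unfolding in_projection_def by blast+
  ultimately show ?thesis
    by (auto simp: lo_le_iff le_hi_iff)
qed

text \<open>If the coordinates above \<open>k\<close> already leave the projection, the range of
  coordinate \<open>k\<close> is empty and the integral takes its default 0. At level 0 the
  integrand is evaluated without such a check, hence \<open>0 < k\<close>.\<close>

lemma iterated_eq_0:
  assumes "\<not> in_projection k v" and "0 < k" and "k \<le> n"
  shows "iterated_q_integral q n D f k v = 0"
proof -
  obtain k' where "k = Suc k'"
    using assms by (cases k) auto
  then show ?thesis
    using assms in_projection_upd_iff[of k' v] by (simp add: coord_range_D)
qed

lemma iterated_Suc:
  assumes "in_projection (Suc k) v" and "k < n"
  shows "iterated_q_integral q n D f (Suc k) v =
    q_integral q (lo k v) (hi k v) (\<lambda>t. iterated_q_integral q n D f k (v(Suc k := t)))"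
proof -
  have "coord_range n D (Suc k) v = {lo k v..hi k v}"
    unfolding coord_range_D[OF assms(2)] in_projection_upd_iff[OF assms(2)] using assms(1) by auto
  then show ?thesis
    using lo_le_hi[OF assms(1)] by simp
qed

text \<open>The counterpart of \<open>in_projection\<close> for exponents. Larger exponents mean
  smaller powers of \<open>q\<close>, which reverses the order.\<close>

definition compatible :: "nat \<Rightarrow> (nat \<Rightarrow> nat) \<Rightarrow> bool" where
  "compatible k s \<longleftrightarrow> (\<forall>i\<in>{k<..n}. \<forall>j\<in>{k<..n}. (i, j) \<in> R \<longrightarrow> s j \<le> s i \<and> (j < i \<longrightarrow> s j < s i))"

definition P_partitions_extending :: "nat \<Rightarrow> (nat \<Rightarrow> nat) \<Rightarrow> (nat \<Rightarrow> nat) set" where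
  "P_partitions_extending k s = {\<sigma> \<in> P_partitions {1..n} R id. \<forall>j\<in>{k<..n}. \<sigma> j = s j}"

lemma P_partitions_eq_compatible:
  "P_partitions {1..n} R id = {\<sigma> \<in> {1..n} \<rightarrow>\<^sub>E UNIV. compatible 0 \<sigma>}"
  by (auto simp: P_partitions_def compatible_def)

text \<open>All labels \<open>j\<close> involved exceed \<open>Suc k\<close>, so the new inequality
  is strict exactly when \<open>j\<close> lies below \<open>Suc k\<close> in the poset.\<close>

lemma compatible_upd_iff:
  assumes "k < n"
  shows "compatible k (s(Suc k := m)) \<longleftrightarrow> compatible (Suc k) s \<and>
    (\<forall>j\<in>{Suc k<..n}. (j, Suc k) \<in> R \<longrightarrow> m < s j) \<and> (\<forall>j\<in>{Suc k<..n}. (Suc k, j) \<in> R \<longrightarrow> s j \<le> m)"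
  using assms unfolding compatible_def greaterThanAtMost_Suc_left[OF assms]
  by (auto simp: less_imp_le)

lemma compatible_antimono: "compatible k s \<Longrightarrow> k \<le> l \<Longrightarrow> compatible l s"
  by (auto simp: compatible_def)

lemma compatible_cong: "(\<And>j. j \<in> {k<..n} \<Longrightarrow> s j = s' j) \<Longrightarrow> compatible k s \<longleftrightarrow> compatible k s'"
  by (simp add: compatible_def)

lemma P_partitions_extending_0:
  assumes "compatible 0 s"
  shows "P_partitions_extending 0 s = {restrict s {1..n}}"
proof -
  have "compatible 0 (restrict s {1..n})"
    using assms by (subst compatible_cong[of 0 _ s]) auto
  then have "restrict s {1..n} \<in> P_partitions_extending 0 s"
    by (simp add: P_partitions_extending_def P_partitions_eq_compatible del: One_nat_def)
  moreover have "\<sigma> = restrict s {1..n}" if "\<sigma> \<in> P_partitions_extending 0 s" for \<sigma>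
  proof (rule PiE_ext)
    show "\<sigma> \<in> {1..n} \<rightarrow>\<^sub>E UNIV"
      using that by (simp add: P_partitions_extending_def P_partitions_def)
  qed (use that in \<open>auto simp: P_partitions_extending_def\<close>)
  ultimately show ?thesis
    by blast
qed

section \<open>Evaluation of the iterated integral at powers of \<open>q\<close>\<close>

context
  fixes q :: real
  assumes q: "0 < q" "q < 1"
begin

text \<open>An extension is determined by its values on \<open>{1..k}\<close>. Comparison with all
  functions on \<open>{1..k}\<close>, whose sum is a product of \<open>k\<close> geometric series,
  gives both claims; the bound will keep inner integrals at most 1.\<close>

lemma
  assumes "k \<le> n"
  shows summable_P_partitions_extending:
      "(\<lambda>\<sigma>. q ^ (\<Sum>i\<in>{1..k}. \<sigma> i)) summable_on P_partitions_extending k s"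
    and infsum_P_partitions_extending_le:
      "(\<Sum>\<^sub>\<infinity>\<sigma>\<in>P_partitions_extending k s. q ^ (\<Sum>i\<in>{1..k}. \<sigma> i)) \<le> (1 / (1 - q)) ^ k"
proof -
  let ?f = "\<lambda>\<sigma>. q ^ (\<Sum>i\<in>{1..k}. \<sigma> i)"
  let ?E = "P_partitions_extending k s"
  let ?r = "\<lambda>\<sigma>. restrict \<sigma> {1..k}"
  have inj: "inj_on ?r ?E"
  proof (rule inj_onI)
    fix \<sigma> \<tau> assume *: "\<sigma> \<in> ?E" "\<tau> \<in> ?E" and eq: "?r \<sigma> = ?r \<tau>"
    show "\<sigma> = \<tau>"
    proof (rule PiE_ext)
      show "\<sigma> \<in> {1..n} \<rightarrow>\<^sub>E UNIV" "\<tau> \<in> {1..n} \<rightarrow>\<^sub>E UNIV"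
        using * by (auto simp: P_partitions_extending_def P_partitions_def)
      show "\<sigma> i = \<tau> i" if "i \<in> {1..n}" for i
        using that * fun_cong[OF eq, of i]
        by (cases "i \<le> k") (auto simp: P_partitions_extending_def)
    qed
  qed
  have all: "?f summable_on ({1..k} \<rightarrow>\<^sub>E UNIV)" and
    all_eq: "(\<Sum>\<^sub>\<infinity>\<sigma>\<in>{1..k} \<rightarrow>\<^sub>E UNIV. ?f \<sigma>) = (1 / (1 - q)) ^ k"
    using summable_power_PiE[OF q, of "{1..k}" "\<lambda>_. 1"] infsum_power_PiE[OF q, of "{1..k}" "\<lambda>_. 1"]
    by simp_all
  have image: "?f summable_on (?r ` ?E)"
    by (rule summable_on_subset_banach[OF all]) auto
  then show "?f summable_on ?E"
    using summable_on_reindex[OF inj, of ?f] by (simp add: o_def)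
  have "infsum ?f ?E = infsum ?f (?r ` ?E)"
    using infsum_reindex[OF inj, of ?f] by (simp add: o_def)
  also have "\<dots> \<le> (\<Sum>\<^sub>\<infinity>\<sigma>\<in>{1..k} \<rightarrow>\<^sub>E UNIV. ?f \<sigma>)"
    by (rule infsum_mono_neutral[OF image all]) (use q in auto)
  finally show "infsum ?f ?E \<le> (1 / (1 - q)) ^ k"
    by (simp only: all_eq)
qed

text \<open>Grouping by the value \<open>m\<close> at \<open>Suc k\<close> mirrors one
  q-integration, with \<open>q ^ m\<close> as the weight of the sample.\<close>

lemma infsum_P_partitions_extending_Suc:
  assumes "k < n"
  shows "(\<Sum>\<^sub>\<infinity>\<sigma>\<in>P_partitions_extending (Suc k) s. q ^ (\<Sum>i\<in>{1..Suc k}. \<sigma> i)) =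
    (\<Sum>\<^sub>\<infinity>m\<in>{m. compatible k (s(Suc k := m))}.
       (\<Sum>\<^sub>\<infinity>\<sigma>\<in>P_partitions_extending k (s(Suc k := m)). q ^ (\<Sum>i\<in>{1..k}. \<sigma> i)) * q ^ m)"
proof -
  let ?E = "P_partitions_extending"
  have fibre: "{\<sigma> \<in> ?E (Suc k) s. \<sigma> (Suc k) = m} = ?E k (s(Suc k := m))" for m
    using assms by (auto simp: P_partitions_extending_def greaterThanAtMost_Suc_left)
  have "compatible k (s(Suc k := \<sigma> (Suc k)))" if "\<sigma> \<in> ?E (Suc k) s" for \<sigma>
  proof -
    have "compatible k \<sigma>"
      using that compatible_antimono[of 0 \<sigma> k]
      unfolding P_partitions_extending_def P_partitions_eq_compatible by blast
    moreover have "\<sigma> j = (s(Suc k := \<sigma> (Suc k))) j" if "j \<in> {k<..n}" for j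
      using \<open>\<sigma> \<in> ?E (Suc k) s\<close> that by (auto simp: P_partitions_extending_def)
    ultimately show ?thesis
      using compatible_cong by blast
  qed
  then have "(\<lambda>\<sigma>. \<sigma> (Suc k)) ` ?E (Suc k) s \<subseteq> {m. compatible k (s(Suc k := m))}"
    by blast
  with summable_P_partitions_extending[of "Suc k" s] assms
  have "(\<Sum>\<^sub>\<infinity>\<sigma>\<in>?E (Suc k) s. q ^ (\<Sum>i\<in>{1..Suc k}. \<sigma> i)) =
      (\<Sum>\<^sub>\<infinity>m\<in>{m. compatible k (s(Suc k := m))}.
         \<Sum>\<^sub>\<infinity>\<sigma>\<in>?E k (s(Suc k := m)). q ^ (\<Sum>i\<in>{1..Suc k}. \<sigma> i))"
    unfolding fibre[symmetric] by (intro infsum_fibres) auto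
  also have "\<dots> = (\<Sum>\<^sub>\<infinity>m\<in>{m. compatible k (s(Suc k := m))}.
       (\<Sum>\<^sub>\<infinity>\<sigma>\<in>?E k (s(Suc k := m)). q ^ (\<Sum>i\<in>{1..k}. \<sigma> i)) * q ^ m)"
  proof (rule infsum_cong)
    fix m
    have "(\<Sum>\<^sub>\<infinity>\<sigma>\<in>?E k (s(Suc k := m)). q ^ (\<Sum>i\<in>{1..Suc k}. \<sigma> i)) =
        (\<Sum>\<^sub>\<infinity>\<sigma>\<in>?E k (s(Suc k := m)). q ^ (\<Sum>i\<in>{1..k}. \<sigma> i) * q ^ m)"
      unfolding fibre[symmetric] by (rule infsum_cong) (simp add: power_add)
    then show "(\<Sum>\<^sub>\<infinity>\<sigma>\<in>?E k (s(Suc k := m)). q ^ (\<Sum>i\<in>{1..Suc k}. \<sigma> i)) =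
        (\<Sum>\<^sub>\<infinity>\<sigma>\<in>?E k (s(Suc k := m)). q ^ (\<Sum>i\<in>{1..k}. \<sigma> i)) * q ^ m"
      by (simp only: infsum_cmult_left')
  qed
  finally show ?thesis .
qed

lemma in_projection_power:
  assumes "compatible k s" and "\<And>j. j \<in> {k<..n} \<Longrightarrow> v j = q ^ s j"
  shows "in_projection k v"
  using assms q
  by (auto simp: in_projection_def compatible_def power_le_one power_decreasing)

text \<open>
  Once the outer coordinates are powers \<open>q\<^sup>s\<close>, the samples \<open>q\<^sup>m\<close> that survive in the next
  q-integral are those with \<open>v\<^sub>j < q\<^sup>m\<close> for \<open>j <\<^sub>P k + 1\<close> and \<open>q\<^sup>m \<le> v\<^sub>j\<close> for \<open>j >\<^sub>P k + 1\<close>. As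
  \<open>j > k + 1\<close>, these are the strict and weak inequalities of a \<open>(P, \<omega>)\<close>-partition.
\<close>

lemma iterated_q_integral_D:
  assumes "k \<le> n" and "compatible k s" and "\<And>j. j \<in> {k<..n} \<Longrightarrow> v j = q ^ s j"
  shows "iterated_q_integral q n D (\<lambda>_. 1) k v =
    (1 - q) ^ k * (\<Sum>\<^sub>\<infinity>\<sigma>\<in>P_partitions_extending k s. q ^ (\<Sum>i\<in>{1..k}. \<sigma> i))"
  using assms
proof (induction k arbitrary: s v)
  case 0
  then show ?case
    by (simp add: P_partitions_extending_0)
next
  case (Suc k)
  let ?I = "\<lambda>m. iterated_q_integral q n D (\<lambda>_. 1) k (v(Suc k := q ^ m))"
  let ?G = "\<lambda>m. \<Sum>\<^sub>\<infinity>\<sigma>\<in>P_partitions_extending k (s(Suc k := m)). q ^ (\<Sum>i\<in>{1..k}. \<sigma> i)"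
  have k: "k < n"
    using Suc.prems by simp
  have v: "v j = q ^ s j" if "j \<in> {Suc k<..n}" for j
    using Suc.prems that by blast
  have proj: "in_projection (Suc k) v"
    using in_projection_power Suc.prems by blast
  have allowed: "compatible k (s(Suc k := m)) \<longleftrightarrow> lo k v < q ^ m \<and> q ^ m \<le> hi k v" for m
    using Suc.prems q v k
    by (auto simp: compatible_upd_iff lo_less_iff le_hi_iff power_le_one
        power_strict_decreasing_iff power_decreasing_iff)
  have IH: "?I m = (1 - q) ^ k * ?G m" if "compatible k (s(Suc k := m))" for m
    by (rule Suc.IH[OF _ that]) (use that k v in auto)
  have I_le_1: "norm (?I m) \<le> 1" if "compatible k (s(Suc k := m))" for m
  proof -
    have "?G m \<le> (1 / (1 - q)) ^ k" and "0 \<le> ?G m"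
      using infsum_P_partitions_extending_le[of k "s(Suc k := m)"] k q
      by (auto intro!: infsum_nonneg)
    then show ?thesis
      using q unfolding IH[OF that]
      by (simp add: abs_mult power_divide field_simps)
  qed
  \<comment> \<open>Each limit is the maximum or minimum of a finite set, hence an outer coordinate,
    0, or \<open>1 = q ^ 0\<close>.\<close>
  have "lo k v \<in> insert 0 (v ` {Suc k<..n})"
    using Max_in[of "insert 0 (v ` {j \<in> {Suc k<..n}. (j, Suc k) \<in> R})"] by (auto simp: lo_def)
  then obtain a where a: "lo k v = 0 \<or> lo k v = q ^ a"
    using v by auto
  have "hi k v \<in> insert 1 (v ` {Suc k<..n})"
    using Min_in[of "insert 1 (v ` {j \<in> {Suc k<..n}. (Suc k, j) \<in> R})"] by (auto simp: hi_def)
  then obtain b where b: "hi k v = q ^ b"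
    using v power_0[of q] by (auto; metis)
  \<comment> \<open>For \<open>k > 0\<close>, a sample beyond \<open>a\<close> is either compatible
    or outside the projection, where the inner integral is 0. The sample \<open>m = a\<close> may be
    the excluded endpoint \<open>lo k v\<close>, which the induction hypothesis does not cover;
    finitely many samples do not affect summability.\<close>
  have tail_le_1: "norm (?I m) \<le> 1" if "a < m" for m
  proof (cases "compatible k (s(Suc k := m)) \<or> k = 0")
    case True
    then show ?thesis
      using I_le_1 by auto
  next
    case False
    have "lo k v \<noteq> q ^ m"
      using a that q by (auto simp: power_inject_exp')
    then have "\<not> in_projection k (v(Suc k := q ^ m))"
      using False k allowed[of m] by (auto simp: in_projection_upd_iff)
    then show ?thesis
      using iterated_eq_0 False k by simp
  qed
  have "summable (\<lambda>m. norm (?I m * q ^ m))"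
  proof (rule summable_comparison_test)
    have "norm (norm (?I m * q ^ m)) \<le> q ^ m" if "Suc a \<le> m" for m
      using tail_le_1[of m] that q by (simp add: abs_mult mult_left_le_one_le)
    then show "\<exists>N. \<forall>m\<ge>N. norm (norm (?I m * q ^ m)) \<le> q ^ m"
      by blast
    show "summable (\<lambda>m. q ^ m)"
      using q by (simp add: summable_geometric)
  qed
  then have "(\<lambda>m. ?I m * q ^ m) summable_on UNIV"
    by (rule norm_summable_imp_summable_on)
  then have "iterated_q_integral q n D (\<lambda>_. 1) (Suc k) v =
      (1 - q) * (\<Sum>\<^sub>\<infinity>m\<in>{m. compatible k (s(Suc k := m))}. ?I m * q ^ m)"
    unfolding allowed iterated_Suc[OF proj k]
    by (intro q_integral_lattice[OF q a b lo_le_hi[OF proj]])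
  also have "(\<Sum>\<^sub>\<infinity>m\<in>{m. compatible k (s(Suc k := m))}. ?I m * q ^ m) =
      (\<Sum>\<^sub>\<infinity>m\<in>{m. compatible k (s(Suc k := m))}. (1 - q) ^ k * (?G m * q ^ m))"
    using IH by (intro infsum_cong) simp
  also have "\<dots> = (1 - q) ^ k *
      (\<Sum>\<^sub>\<infinity>\<sigma>\<in>P_partitions_extending (Suc k) s. q ^ (\<Sum>i\<in>{1..Suc k}. \<sigma> i))"
    unfolding infsum_P_partitions_extending_Suc[OF k] by (rule infsum_cmult_right')
  finally show ?case
    by (simp add: mult.assoc)
qed

text \<open>For \<open>k = n\<close> no outer coordinate is left: the conditions on \<open>s\<close>
  and \<open>v\<close> are vacuous, and every P-partition is an extension.\<close>

theorem q_volume_D: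
  "q_volume q n D = (1 - q) ^ n * (\<Sum>\<^sub>\<infinity>\<sigma>\<in>P_partitions {1..n} R id. q ^ (\<Sum>i\<in>{1..n}. \<sigma> i))"
  using iterated_q_integral_D[of n undefined "\<lambda>_. undefined"]
  by (simp add: q_volume_def polytope_q_integral_def compatible_def P_partitions_extending_def)

end

end

section \<open>Transfer from labels to an arbitrary carrier\<close>

theorem theorem4p4:
  fixes q :: real and n :: nat
    and x :: "nat \<Rightarrow> 'a" and P :: "'a set" and r :: "('a \<times> 'a) set" and \<omega> :: "'a \<Rightarrow> nat"
  assumes "0 < q" and "q < 1"
    and "inj_on x {1..n}" and "P = x ` {1..n}"
    and "partial_order_on P r"
    and "\<And>i. i \<in> {1..n} \<Longrightarrow> \<omega> (x i) = i"
  shows "q_volume q n (order_polytope n x r) =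
           polytope_q_integral q n (order_polytope n x r) (\<lambda>_. 1) \<and>
         q_volume q n (order_polytope n x r) =
           (1 - q) ^ n * (\<Sum>\<^sub>\<infinity>\<sigma> \<in> P_partitions P r \<omega>. q ^ (\<Sum>s\<in>P. \<sigma> s)) \<and>
         q_volume q n (order_polytope n x r) =
           1 / q_fact q n * (\<Sum>\<pi> \<in> Jordan_Hoelder P r \<omega>. q ^ maj \<pi>)"
proof -
  note q = assms(1,2) and inj = assms(3) and P = assms(4) and po = assms(5) and \<omega> = assms(6)
  \<comment> \<open>The order is moved to the labels, where the labeling becomes the identity;
    antisymmetry survives because \<open>x\<close> is injective.\<close>
  define R where "R = {(i, j). i \<in> {1..n} \<and> j \<in> {1..n} \<and> (x i, x j) \<in> r}"
  have \<omega>_in: "\<omega> s \<in> {1..n}" "x (\<omega> s) = s" if "s \<in> P" for s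
    using that P \<omega> by auto
  have R_iff: "(\<omega> s, \<omega> t) \<in> R \<longleftrightarrow> (s, t) \<in> r" if "s \<in> P" "t \<in> P" for s t
    using that \<omega>_in[of s] \<omega>_in[of t] by (simp add: R_def)
  have bij: "bij_betw x {1..n} P"
    using inj P by (simp add: bij_betw_def)
  have bij_\<omega>: "bij_betw \<omega> P {1..n}"
    by (rule bij_betw_byWitness[where f' = x]) (use \<omega>_in P \<omega> in auto)
  have "partial_order_on {1..n} R"
    unfolding partial_order_on_def preorder_on_def
  proof (intro conjI)
    have r: "refl_on P r" "trans r" "antisym r"
      using po by (simp_all add: partial_order_on_def preorder_on_def)
    show "R \<subseteq> {1..n} \<times> {1..n}"
      by (auto simp: R_def)
    show "refl_on {1..n} R"
      using r(1) P by (simp add: refl_on_def R_def)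
    show "trans R"
      using r(2) unfolding R_def trans_def by blast
    show "antisym R"
      using r(3) inj_onD[OF inj] unfolding R_def antisym_def by blast
  qed
  then interpret labeled_poset n R
    by unfold_locales
  have D: "order_polytope n x r = D"
    by (auto simp: order_polytope_def R_def)
  have bij_PP: "bij_betw (\<lambda>\<sigma>. \<lambda>i\<in>{1..n}. \<sigma> (x i)) (P_partitions P r \<omega>) (P_partitions {1..n} R id)"
  proof (rule bij_betw_byWitness[where f' = "\<lambda>\<tau>. \<lambda>s\<in>P. \<tau> (\<omega> s)"])
    show "\<forall>\<sigma>\<in>P_partitions P r \<omega>. (\<lambda>s\<in>P. (\<lambda>i\<in>{1..n}. \<sigma> (x i)) (\<omega> s)) = \<sigma>"
      using \<omega>_in by (auto simp: P_partitions_def PiE_iff extensional_def fun_eq_iff)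
    show "\<forall>\<tau>\<in>P_partitions {1..n} R id. (\<lambda>i\<in>{1..n}. (\<lambda>s\<in>P. \<tau> (\<omega> s)) (x i)) = \<tau>"
      using P \<omega> by (auto simp: P_partitions_def PiE_iff extensional_def fun_eq_iff)
    show "(\<lambda>\<sigma>. \<lambda>i\<in>{1..n}. \<sigma> (x i)) ` P_partitions P r \<omega> \<subseteq> P_partitions {1..n} R id"
      using P \<omega> by (auto simp: P_partitions_def R_def)
    show "(\<lambda>\<tau>. \<lambda>s\<in>P. \<tau> (\<omega> s)) ` P_partitions {1..n} R id \<subseteq> P_partitions P r \<omega>"
      using \<omega>_in R_iff by (fastforce simp: P_partitions_def)
  qed
  have "(\<Sum>i\<in>{1..n}. (\<lambda>i\<in>{1..n}. \<sigma> (x i)) i) = (\<Sum>s\<in>P. \<sigma> s)" for \<sigma> :: "'a \<Rightarrow> nat"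
    using sum.reindex_bij_betw[OF bij, of \<sigma>] by simp
  then have PP: "(\<Sum>\<^sub>\<infinity>\<sigma>\<in>P_partitions P r \<omega>. q ^ (\<Sum>s\<in>P. \<sigma> s)) =
      (\<Sum>\<^sub>\<infinity>\<tau>\<in>P_partitions {1..n} R id. q ^ (\<Sum>i\<in>{1..n}. \<tau> i))"
    using infsum_reindex_bij_betw[OF bij_PP, of "\<lambda>\<tau>. q ^ (\<Sum>i\<in>{1..n}. \<tau> i)"] by simp
  have JH: "Jordan_Hoelder P r \<omega> = linear_extensions {1..n} R"
  proof (intro subset_antisym subsetI)
    fix \<pi> assume "\<pi> \<in> Jordan_Hoelder P r \<omega>"
    then obtain ts where ts: "ts \<in> permutations_of_set P" "\<pi> = map \<omega> ts"
      and ext: "\<forall>i<length ts. \<forall>j<length ts. (ts ! i, ts ! j) \<in> r \<and> ts ! i \<noteq> ts ! j \<longrightarrow> i < j"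
      by (auto simp: Jordan_Hoelder_def linear_extensions_def)
    have "ts ! i \<in> P" if "i < length ts" for i
      using ts that nth_mem by (fastforce simp: permutations_of_set_def)
    then have "(ts ! i, ts ! j) \<in> r \<and> ts ! i \<noteq> ts ! j" if "i < length ts" "j < length ts"
      "(\<omega> (ts ! i), \<omega> (ts ! j)) \<in> R" "\<omega> (ts ! i) \<noteq> \<omega> (ts ! j)" for i j
      using that R_iff by metis
    moreover have "\<pi> \<in> permutations_of_set {1..n}"
      using ts bij_\<omega> by (auto simp: permutations_of_set_def distinct_map bij_betw_def)
    ultimately show "\<pi> \<in> linear_extensions {1..n} R"
      using ts ext by (auto simp: linear_extensions_def)
  next
    fix \<pi> assume "\<pi> \<in> linear_extensions {1..n} R"
    then have \<pi>: "\<pi> \<in> permutations_of_set {1..n}"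
      and ext: "\<forall>i<length \<pi>. \<forall>j<length \<pi>. (\<pi> ! i, \<pi> ! j) \<in> R \<and> \<pi> ! i \<noteq> \<pi> ! j \<longrightarrow> i < j"
      by (auto simp: linear_extensions_def)
    have in_n: "\<pi> ! i \<in> {1..n}" if "i < length \<pi>" for i
      using \<pi> that nth_mem by (fastforce simp: permutations_of_set_def)
    have "map x \<pi> \<in> permutations_of_set P"
      using \<pi> inj P by (auto simp: permutations_of_set_def distinct_map)
    moreover have "(\<pi> ! i, \<pi> ! j) \<in> R \<and> \<pi> ! i \<noteq> \<pi> ! j" if "i < length \<pi>" "j < length \<pi>"
      "(x (\<pi> ! i), x (\<pi> ! j)) \<in> r" "x (\<pi> ! i) \<noteq> x (\<pi> ! j)" for i j
      using that in_n by (auto simp: R_def)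
    ultimately have "map x \<pi> \<in> linear_extensions P r"
      using ext by (auto simp: linear_extensions_def)
    moreover have "map \<omega> (map x \<pi>) = \<pi>"
      using \<pi> \<omega> by (auto simp: permutations_of_set_def intro!: map_idI)
    ultimately show "\<pi> \<in> Jordan_Hoelder P r \<omega>"
      unfolding Jordan_Hoelder_def by (metis imageI)
  qed
  \<comment> \<open>Each of the \<open>n\<close> brackets contributes one factor
    \<open>1 - q\<close>; the shift from \<open>{1..n}\<close> to \<open>{..<n}\<close> produces
    \<open>Suc i\<close>.\<close>
  have "1 / q_fact q n = (\<Prod>i<n. (1 - q) / (1 - q ^ Suc i))"
    unfolding q_fact_def q_bracket_def One_nat_def prod.atLeast1_atMost_eq by (simp add: prod_dividef)
  also have "\<dots> = (1 - q) ^ n * (\<Prod>i<n. 1 / (1 - q ^ Suc i))"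
    by (simp add: prod_dividef)
  finally have fact: "1 / q_fact q n = (1 - q) ^ n * (\<Prod>i<n. 1 / (1 - q ^ Suc i))" .
  have "q_volume q n (order_polytope n x r) =
      (1 - q) ^ n * (\<Sum>\<^sub>\<infinity>\<sigma>\<in>P_partitions P r \<omega>. q ^ (\<Sum>s\<in>P. \<sigma> s))"
    unfolding D PP by (rule q_volume_D[OF q])
  moreover have "q_volume q n (order_polytope n x r) =
      1 / q_fact q n * (\<Sum>\<pi>\<in>Jordan_Hoelder P r \<omega>. q ^ maj \<pi>)"
    unfolding D fact JH q_volume_D[OF q] infsum_P_partitions[OF q R_subset] by (simp only: mult_ac)
  ultimately show ?thesis
    by (simp only: q_volume_def)
qed

end
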